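(* Every Heron triangle having two sides whose lengths are perfect squares corresponds, in the sense described below, to a non-trivial rational point $(X,Y)$ on the elliptic curve \[ \mathcal{E}_k:\ Y^2 = X^3 + \big(2(k^4-1)\big)^2 X \] for some rational number $k$ with $k^4\neq 1$, where the point satisfies \[ Y>\frac{2k\big(3X^3 - 2(3k^4 + 2k^2 + 3)X^2 + 4(k^4 - 1)^2X - 8(k^2 + 1)^2(k^2 - 1)^4\big)}{(X - 2(k^2 - 1)^2)^2 + 16k^2(k^2 - 1)^2}. \] Conversely, every such non-trivial rational point on $\mathcal{E}_k$ satisfying this inequality corresponds to a Heron triangle having two sides whose lengths are perfect squares.
   Context: A Heron triangle is a (non-degenerate) triangle whose three side lengths and whose area are all positive integers. The correspondence is as follows. A Heron triangle with two perfect-square sides is, after scaling by a positive rational factor, a triangle with side lengths $1$, $q^2$, $r$ with $q,r$ rational, $r>0$; placing it with vertices $(0,0)$, $(r,0)$, $(s,t)$ where $s^2+t^2=1$, $s=\frac{2k}{k^2+1}$, $t=\frac{k^2-1}{k^2+1}$ ($k$ rational), one has $q^4 = r^2 - \frac{4k}{k^2+1} r + 1$. A rational point $(X,Y)$ on $\mathcal{E}_k$ yields $(r,q)$ via \[ r=\frac{4(k^2+1)\,R(k,X,Y)}{\big(X-2(k^2+1)(k-1)^2\big)^2\big(X-2(k^2+1)(k+1)^2\big)^2},\qquad q=\frac{4Yk-X^2+4(k^4-1)^2}{\big(X-2(k^2+1)(k-1)^2\big)\big(X-2(k^2+1)(k+1)^2\big)}, \] where \[ R(k,X,Y)=\big((X-2(k^2-1)^2)^2+16k^2(k^2-1)^2\big)Y-2k\big(3X^3-2(3k^4+2k^2+3)X^2+4(k^4-1)^2X-8(k^2+1)^2(k^2-1)^4\big),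 \] and the triangle is the one with sides $1,q^2,r$ scaled to integers; conversely $(X,Y)$ is obtained from $(k,r,q)$ by the inverse birational change of variables. A non-trivial rational point means an affine rational point of $\mathcal{E}_k$ at which these formulas are defined and give $r\neq 0$. The inequality on $Y$ is equivalent to $r>0$. *)

theory Defs
  imports "HOL-Analysis.Analysis" "HOL-Library.Multiset"
begin

definition side_lengths :: "real^2 \<Rightarrow> real^2 \<Rightarrow> real^2 \<Rightarrow> real multiset" where
  "side_lengths A B C = {#dist A B, dist B C, dist C A#}"

definition heron_triangle :: "real^2 \<Rightarrow> real^2 \<Rightarrow> real^2 \<Rightarrow> bool" where
  "heron_triangle A B C \<longleftrightarrow>
     \<not> collinear {A, B, C} \<and>
     (\<forall>l \<in># side_lengths A B C. l \<in> \<nat> \<and> 0 < l) \<and>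
     measure lborel (convex hull {A, B, C}) \<in> \<nat> \<and> 0 < measure lborel (convex hull {A, B, C})"

definition perfect_square :: "real \<Rightarrow> bool" where
  "perfect_square x \<longleftrightarrow> (\<exists>n::nat. x = (real n)\<^sup>2)"

definition two_square_sides :: "real^2 \<Rightarrow> real^2 \<Rightarrow> real^2 \<Rightarrow> bool" where
  "two_square_sides A B C \<longleftrightarrow>
     perfect_square (dist A B) \<and> perfect_square (dist B C) \<or>
     perfect_square (dist B C) \<and> perfect_square (dist C A) \<or>
     perfect_square (dist C A) \<and> perfect_square (dist A B)"

definition on_curve :: "rat \<Rightarrow> rat \<Rightarrow> rat \<Rightarrow> bool" where
  "on_curve k X Y \<longleftrightarrow> Y^2 = X^3 + (2 * (k^4 - 1))^2 * X"

definition poly_R :: "rat \<Rightarrow> rat \<Rightarrow> rat \<Rightarrow> rat" where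
  "poly_R k X Y =
     ((X - 2 * (k^2 - 1)^2)^2 + 16 * k^2 * (k^2 - 1)^2) * Y
     - 2 * k * (3 * X^3 - 2 * (3 * k^4 + 2 * k^2 + 3) * X^2 + 4 * (k^4 - 1)^2 * X
                - 8 * (k^2 + 1)^2 * (k^2 - 1)^4)"

definition denom :: "rat \<Rightarrow> rat \<Rightarrow> rat" where
  "denom k X = (X - 2 * (k^2 + 1) * (k - 1)^2) * (X - 2 * (k^2 + 1) * (k + 1)^2)"

definition r_of :: "rat \<Rightarrow> rat \<Rightarrow> rat \<Rightarrow> rat" where
  "r_of k X Y = 4 * (k^2 + 1) * poly_R k X Y / (denom k X)^2"

definition q_of :: "rat \<Rightarrow> rat \<Rightarrow> rat \<Rightarrow> rat" where
  "q_of k X Y = (4 * Y * k - X^2 + 4 * (k^4 - 1)^2) / denom k X"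

definition nontrivial_point :: "rat \<Rightarrow> rat \<Rightarrow> rat \<Rightarrow> bool" where
  "nontrivial_point k X Y \<longleftrightarrow> on_curve k X Y \<and> denom k X \<noteq> 0 \<and> r_of k X Y \<noteq> 0"

definition apex :: "rat \<Rightarrow> real^2" where
  "apex k = vector [of_rat (2 * k / (k^2 + 1)), of_rat ((k^2 - 1) / (k^2 + 1))]"

text \<open>
  The placed triangle has vertices \<open>P = (0,0)\<close>, \<open>Q = (r,0)\<close>, \<open>S = (s,t)\<close>; \<open>A B C\<close> is that triangle
  scaled by \<open>\<mu>\<close>, up to congruence and the labelling of its vertices. Only \<open>q\<^sup>2\<close> is a side, so the
  sign of \<open>q\<close> is not determined by the triangle.
\<close>

definition corresponds ::
  "real^2 \<Rightarrow> real^2 \<Rightarrow> real^2 \<Rightarrow> rat \<Rightarrow> rat \<Rightarrow> rat \<Rightarrow> bool" where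
  "corresponds A B C k X Y \<longleftrightarrow>
     (let r = of_rat (r_of k X Y) :: real;
          q = of_rat (q_of k X Y) :: real;
          P = vector [0, 0] :: real^2;
          Q = vector [r, 0] :: real^2;
          S = apex k
      in dist P S = 1 \<and> dist S Q = q\<^sup>2 \<and> dist P Q = r \<and>
         (\<exists>\<mu>::rat. 0 < \<mu> \<and>
            side_lengths A B C = image_mset ((*) (of_rat \<mu>)) {#1, q\<^sup>2, r#}))"

end

theory Submission
  imports Defs
begin

text \<open>
  Put \<open>s = 2k/(k\<^sup>2+1)\<close>, \<open>t = (k\<^sup>2-1)/(k\<^sup>2+1)\<close>, \<open>w = r - s\<close>. The cosine rule for the placed triangle is
  the quartic \<open>w\<^sup>2 = q\<^sup>4 - t\<^sup>2\<close>. With \<open>X = 2(k\<^sup>2+1)\<^sup>2 x\<close> and \<open>Y = 4(k\<^sup>2+1)\<^sup>3 y\<close> the elliptic curve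
  becomes \<open>2y\<^sup>2 = x\<^sup>3 + t\<^sup>2 x\<close>, and the birational map sends \<open>(q, w) = (-1, -s)\<close> to the point at
  infinity. Its inverse is
  \<open>x = (q\<^sup>2 - s w - t\<^sup>2)/(q+1)\<^sup>2\<close>, \<open>y = (w (q + t\<^sup>2) - s (q\<^sup>3 + t\<^sup>2))/(q+1)\<^sup>3\<close>.
  A triangle determines \<open>q\<close> only up to sign, and this freedom is what avoids the points where the
  formulas for \<open>(r, q)\<close> are undefined. The remaining conditions translate directly: \<open>t\<close> is
  rational because the area is, and the bound on \<open>Y\<close> says \<open>r > 0\<close>.
\<close>

section \<open>The curve in normalised coordinates\<close>

text \<open>Here \<open>u / d\<close> and \<open>W / d^2\<close> are \<open>q\<close> and
  \<open>w\<close> as functions of the point \<open>(x, y)\<close>. Clearing denominators makes the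
  quartic a polynomial consequence of the first two equations.\<close>

lemma quartic_identity:
  fixes s t x y d u W :: "'a::field_char_0"
  assumes "s^2 + t^2 = 1" "2 * y^2 = x^3 + t^2 * x"
    and "d = x^2 - 2 * x + t^2" "u = 2 * s * y - x^2 + t^2"
    and "W = 4 * (x^2 - 2 * t^2 * x + t^2) * y - s * (x^2 - t^2) * (x^2 + 2 * x + t^2)"
  shows "W^2 = u^4 - t^2 * d^4"
  using assms by algebra

text \<open>With \<open>q = u / d\<close> and \<open>w = W / d^2\<close> this is the formula for
  \<open>x\<close> in the inverse map, cleared of denominators. It serves to recover
  \<open>w\<close> from \<open>x\<close> and \<open>q\<close>.\<close>

lemma abscissa_identity:
  fixes s t x y d u W :: "'a::field_char_0"
  assumes "s^2 + t^2 = 1" "2 * y^2 = x^3 + t^2 * x"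
    and "d = x^2 - 2 * x + t^2" "u = 2 * s * y - x^2 + t^2"
    and "W = 4 * (x^2 - 2 * t^2 * x + t^2) * y - s * (x^2 - t^2) * (x^2 + 2 * x + t^2)"
  shows "x * (u + d)^2 = u^2 - s * W - t^2 * d^2"
  using assms by algebra

lemma inverse_map:
  fixes s t q w x y d :: "'a::field_char_0"
  assumes st: "s^2 + t^2 = 1" and w: "w^2 = q^4 - t^2" and q: "q \<noteq> -1"
    and x: "x = (q^2 - s * w - t^2) / (q + 1)^2"
    and y: "y = (w * (q + t^2) - s * (q^3 + t^2)) / (q + 1)^3"
    and d: "d = x^2 - 2 * x + t^2"
  shows "2 * y^2 = x^3 + t^2 * x"
    and "q * d = 2 * s * y - x^2 + t^2"
    and "w * d^2 = 4 * (x^2 - 2 * t^2 * x + t^2) * y - s * (x^2 - t^2) * (x^2 + 2 * x + t^2)"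
proof -
  define p where "p = q + 1"
  define N where "N = q^2 - s * w - t^2"
  define M where "M = w * (q + t^2) - s * (q^3 + t^2)"
  have p: "p \<noteq> 0" using q by (simp add: p_def add_eq_0_iff2)
  have N: "N = x * p^2" and M: "M = y * p^3"
    using p by (simp_all add: x y p_def N_def M_def)
  have "2 * M^2 = N^3 + t^2 * N * p^4"
    using st w N_def M_def p_def by algebra
  then have "p^6 * (2 * y^2) = p^6 * (x^3 + t^2 * x)"
    unfolding N M by algebra
  then show curve: "2 * y^2 = x^3 + t^2 * x"
    using p by simp
  have "2 * s * M * p = q * (N^2 - 2 * N * p^2 + t^2 * p^4) + N^2 - t^2 * p^4"
    using st w N_def M_def p_def by algebra
  then have "p^4 * (q * d) = p^4 * (2 * s * y - x^2 + t^2)"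
    unfolding N M d by algebra
  then show qd: "q * d = 2 * s * y - x^2 + t^2"
    using p by simp
  define W where "W = 4 * (x^2 - 2 * t^2 * x + t^2) * y - s * (x^2 - t^2) * (x^2 + 2 * x + t^2)"
  \<comment> \<open>The abscissa involves \<open>w\<close> only through \<open>s * w\<close>, so it
    determines \<open>w\<close> only for \<open>s \<noteq> 0\<close>. For \<open>s = 0\<close> one
    has \<open>t^2 = 1\<close>, and the map is simple enough to compute directly.\<close>
  have "w * d^2 = W"
  proof (cases "s = 0")
    case True
    then have t: "t^2 = 1" using st by simp
    have "p^2 * x = p * (q - 1)"
      using N N_def True t p_def by algebra
    then have px: "p * x = q - 1"
      using p by (simp add: power2_eq_square mult.assoc)
    have "p^3 * y = w * p"
      using M M_def True t p_def by algebra
    then have py: "p^2 * y = w"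
      using p by (simp add: power2_eq_square power3_eq_cube mult.assoc mult.commute)
    have pd: "p^2 * d = 4"
      using px t p_def d by algebra
    have "W = (p^2 * d) * d * y"
      unfolding pd by (simp add: W_def d t True)
    then show ?thesis
      unfolding py[symmetric] by (simp add: power2_eq_square)
  next
    case False
    have "x * (q * d + d)^2 = (q * d)^2 - s * W - t^2 * d^2"
      using abscissa_identity[OF st curve d qd W_def] .
    moreover have "x * (q * d + d)^2 = N * d^2"
      unfolding N p_def by algebra
    ultimately have "s * (w * d^2) = s * W"
      unfolding N_def by algebra
    then show ?thesis using False by simp
  qed
  then show "w * d^2 = 4 * (x^2 - 2 * t^2 * x + t^2) * y - s * (x^2 - t^2) * (x^2 + 2 * x + t^2)"
    by (simp add: W_def)
qed

section \<open>Points where the formulas for \<open>q\<close> and \<open>r\<close> are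
  undefined\<close>

lemma rat_square_neq_2: "(z::rat)^2 \<noteq> 2"
proof
  assume z: "z^2 = 2"
  obtain a b :: int where ab: "z = Fract a b" "b > 0" "coprime a b"
    by (cases z) auto
  have "of_int a = z * of_int b"
    using ab by (simp add: Fract_of_int_quotient)
  then have "(of_int (a^2)::rat) = of_int (2 * b^2)"
    using z by (simp add: power_mult_distrib)
  then have eq: "a^2 = 2 * b^2" by (simp only: of_int_eq_iff)
  then have "even a" by (metis dvd_triv_left even_power pos2)
  then obtain c where "a = 2 * c" by blast
  with eq have "b^2 = 2 * c^2" by (simp add: power2_eq_square)
  then have "even b" by (metis dvd_triv_left even_power pos2)
  with \<open>even a\<close> ab(3) show False
    using coprime_common_divisor[of a b 2] by simp
qed

text \<open>
  The two finite points of the quartic that are lost because the formulas read \<open>0/0\<close> there are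
  swapped by \<open>(q, w) \<mapsto> (-q, -w)\<close>, so one of \<open>(q, w)\<close> and \<open>(-q, w)\<close> always survives. The
  irrationality of \<open>\<surd>2\<close> excludes the case \<open>w = 0\<close>.
\<close>

lemma exceptional_points_sign:
  fixes s t q w :: rat
  assumes st: "s^2 + t^2 = 1" and t: "t \<noteq> 0" and w: "w^2 = q^4 - t^2"
    and q: "q > 0" "q \<noteq> 1"
    and x1: "x\<^sub>1 = (q^2 - s * w - t^2) / (q + 1)^2" and d1: "x\<^sub>1^2 - 2 * x\<^sub>1 + t^2 = 0"
    and x2: "x\<^sub>2 = (q^2 - s * w - t^2) / (1 - q)^2" and d2: "x\<^sub>2^2 - 2 * x\<^sub>2 + t^2 = 0"
  shows False
proof -
  have s: "s \<noteq> 1" "s \<noteq> -1" using st t by auto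
  define N where "N = q^2 - s * w - t^2"
  have N1: "N = x\<^sub>1 * (q + 1)^2" and N2: "N = x\<^sub>2 * (1 - q)^2"
    using q by (simp_all add: x1 x2 N_def)
  \<comment> \<open>Since \<open>t^2 = 1 - s^2\<close>, the quadratic
    \<open>x^2 - 2 * x + t^2\<close> is \<open>(x - 1)^2 - s^2\<close>, with roots
    \<open>1 + s\<close> and \<open>1 - s\<close>.\<close>
  have "(x\<^sub>1 - 1 - s) * (x\<^sub>1 - 1 + s) = 0" using d1 st by algebra
  then have c1: "x\<^sub>1 = 1 + s \<or> x\<^sub>1 = 1 - s" by auto
  have "(x\<^sub>2 - 1 - s) * (x\<^sub>2 - 1 + s) = 0" using d2 st by algebra
  then have c2: "x\<^sub>2 = 1 + s \<or> x\<^sub>2 = 1 - s" by auto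
  \<comment> \<open>The two cases with different roots are exchanged by
    \<open>(s, w) \<mapsto> (-s, -w)\<close>; the primed variables treat both at once.\<close>
  have core: False
    if s': "s'^2 = s^2" and w': "s' * w' = s * w" "w'^2 = w^2"
      and h1: "N = (1 - s') * (q + 1)^2" and h2: "N = (1 + s') * (1 - q)^2" for s' w' :: rat
  proof -
    define z where "z = q^2"
    have sz: "s' * (1 + z) = 2 * q" using h1 h2 z_def by algebra
    have "z > 0" using q by (simp add: z_def)
    have tz: "t^2 * (1 + z)^2 = (1 - z)^2" using sz st s' z_def by algebra
    have ww: "s' * w' = z - t^2 - (1 - s') * (q + 1)^2"
      using h1 N_def w' z_def by algebra
    have "(1 - s') * (q + 1)^2 * (1 + z) = (1 - z)^2" using sz z_def by algebra
    with ww tz have "(1 + z)^2 * (s' * w') = 2 * (z^2 + 2 * z - 1)"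
      by algebra
    moreover have "w'^2 = z^2 - t^2" using w w' z_def by algebra
    \<comment> \<open>The square of \<open>s' * w'\<close> is compared with
      \<open>s'^2 * w'^2\<close>, all in terms of \<open>z\<close>. The first factor,
      \<open>(z + 1)^2 - 2\<close>, has no rational zero.\<close>
    ultimately have "(z^2 + 2 * z - 1) * ((z - 1)^2 * (z + 1)) = 0"
      using sz tz z_def by algebra
    moreover have "z^2 + 2 * z - 1 \<noteq> 0"
    proof
      assume "z^2 + 2 * z - 1 = 0"
      then have "(z + 1)^2 = 2" by algebra
      then show False using rat_square_neq_2 by blast
    qed
    ultimately have "z = 1" using \<open>z > 0\<close> by auto
    then show False using q by (simp add: z_def power2_eq_1_iff)
  qed
  have same: "c = 0" if "N = c * (q + 1)^2" "N = c * (1 - q)^2" for c :: rat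
  proof -
    have "c * (4 * q) = 0" using that by algebra
    then show ?thesis using q by simp
  qed
  show False
    using c1 c2
  proof (elim disjE)
    assume "x\<^sub>1 = 1 + s" "x\<^sub>2 = 1 + s"
    then show False using same[of "1 + s"] N1 N2 s by simp
  next
    assume "x\<^sub>1 = 1 - s" "x\<^sub>2 = 1 - s"
    then show False using same[of "1 - s"] N1 N2 s by simp
  next
    assume "x\<^sub>1 = 1 - s" "x\<^sub>2 = 1 + s"
    then show False using core[of s w] N1 N2 by simp
  next
    assume "x\<^sub>1 = 1 + s" "x\<^sub>2 = 1 - s"
    then show False using core[of "-s" "-w"] N1 N2 by simp
  qed
qed

section \<open>Rational points and rational triangles\<close>

lemma unit_circle_param:
  fixes k :: rat
  defines "s \<equiv> 2 * k / (k^2 + 1)" and "t \<equiv> (k^2 - 1) / (k^2 + 1)"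
  shows "s * (k^2 + 1) = 2 * k" "t * (k^2 + 1) = k^2 - 1" "s^2 + t^2 = 1" "k^2 + 1 > 0"
proof -
  show a: "k^2 + 1 > 0" by (simp add: add_nonneg_pos)
  then show 1: "s * (k^2 + 1) = 2 * k" and 2: "t * (k^2 + 1) = k^2 - 1"
    by (simp_all add: s_def t_def)
  have "(k^2 + 1)^2 * (s^2 + t^2) = (k^2 + 1)^2" using 1 2 by algebra
  then show "s^2 + t^2 = 1" using a by simp
qed

text \<open>Since \<open>k^4 - 1 = a^2 * t\<close> and \<open>2 * k = a * s\<close>, giving
  \<open>X\<close> weight 2 and \<open>Y\<close> weight 3 in \<open>a\<close> collects all powers of
  \<open>a\<close> in front. What remains depends on \<open>k\<close> only through \<open>s\<close>
  and \<open>t\<close>.\<close>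

lemma normalised_coordinates:
  fixes k x y :: rat
  defines "a \<equiv> k^2 + 1" and "s \<equiv> 2 * k / (k^2 + 1)" and "t \<equiv> (k^2 - 1) / (k^2 + 1)"
    and "d \<equiv> x^2 - 2 * x + ((k^2 - 1) / (k^2 + 1))^2"
  shows "on_curve k (2 * a^2 * x) (4 * a^3 * y) \<longleftrightarrow> 2 * y^2 = x^3 + t^2 * x"
    and "denom k (2 * a^2 * x) = 4 * a^4 * d"
    and "q_of k (2 * a^2 * x) (4 * a^3 * y) = (2 * s * y - x^2 + t^2) / d"
    and "d \<noteq> 0 \<Longrightarrow> r_of k (2 * a^2 * x) (4 * a^3 * y) =
      s + (4 * (x^2 - 2 * t^2 * x + t^2) * y - s * (x^2 - t^2) * (x^2 + 2 * x + t^2)) / d^2"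
proof -
  have sa: "s * a = 2 * k" and ta: "t * a = k^2 - 1" and st: "s^2 + t^2 = 1" and a0: "a > 0"
    using unit_circle_param[of k] by (simp_all add: s_def t_def a_def)
  have d: "d = x^2 - 2 * x + t^2" by (simp add: d_def t_def)
  have a: "a = k^2 + 1" by (simp add: a_def)
  have k4: "k^4 - 1 = a^2 * t" using ta a by algebra
  have "(4 * a^3 * y)^2 - ((2 * a^2 * x)^3 + (2 * (k^4 - 1))^2 * (2 * a^2 * x))
      = 8 * a^6 * (2 * y^2 - (x^3 + t^2 * x))"
    unfolding k4 by algebra
  then show "on_curve k (2 * a^2 * x) (4 * a^3 * y) \<longleftrightarrow> 2 * y^2 = x^3 + t^2 * x"
    using a0 unfolding on_curve_def by (metis eq_iff_diff_eq_0 mult_eq_0_iff power_eq_0_iff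
        less_irrefl zero_neq_numeral)
  \<comment> \<open>The zeros of \<open>denom\<close> become the roots \<open>1 - s\<close> and
    \<open>1 + s\<close> of \<open>d\<close>.\<close>
  have km: "2 * (k^2 + 1) * (k - 1)^2 = 2 * a^2 * (1 - s)"
    and kp: "2 * (k^2 + 1) * (k + 1)^2 = 2 * a^2 * (1 + s)"
    using sa a by algebra+
  show den: "denom k (2 * a^2 * x) = 4 * a^4 * d"
    unfolding denom_def km kp d using st by algebra
  have "4 * (4 * a^3 * y) * k - (2 * a^2 * x)^2 + 4 * (k^4 - 1)^2
      = 4 * a^4 * (2 * s * y - x^2 + t^2)"
    unfolding k4 using sa by algebra
  then show "q_of k (2 * a^2 * x) (4 * a^3 * y) = (2 * s * y - x^2 + t^2) / d"
    using a0 unfolding q_of_def den by simp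
  have c: "3 * k^4 + 2 * k^2 + 3 = a^2 * (2 + t^2)"
    using a ta by algebra
  have e: "(2 * a^2 * x - 2 * (k^2 - 1)^2)^2 + 16 * k^2 * (k^2 - 1)^2
      = 4 * a^4 * (x^2 - 2 * t^2 * x + t^2)"
    unfolding ta[symmetric] using sa st by algebra
  \<comment> \<open>\<open>V\<close> is \<open>poly_R\<close> stripped of the factor
    \<open>8 * a^7\<close>, so that \<open>r = 2 * V / d^2\<close>. Splitting \<open>s * d^2\<close>
    off \<open>2 * V\<close> then exposes \<open>w = r - s\<close>.\<close>
  define V where "V = 2 * (x^2 - 2 * t^2 * x + t^2) * y
      - s * (3 * x^3 - (2 + t^2) * x^2 + t^2 * x - t^4)"
  have "poly_R k (2 * a^2 * x) (4 * a^3 * y) = 8 * a^7 * V"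
    unfolding poly_R_def e c k4 unfolding ta[symmetric] a[symmetric] sa[symmetric] V_def
    by algebra
  then have r: "r_of k (2 * a^2 * x) (4 * a^3 * y) = 4 * a * (8 * a^7 * V) / (4 * a^4 * d)^2"
    unfolding r_of_def den a[symmetric] by simp
  have "4 * a * (8 * a^7 * V) = (4 * a^4)^2 * (2 * V)" by algebra
  then have "r_of k (2 * a^2 * x) (4 * a^3 * y) = ((4 * a^4)^2 * (2 * V)) / ((4 * a^4)^2 * d^2)"
    unfolding r power_mult_distrib[of "4 * a^4"] by (simp only:)
  also have "\<dots> = 2 * V / d^2"
    using a0 by (intro mult_divide_mult_cancel_left) simp
  finally have r': "r_of k (2 * a^2 * x) (4 * a^3 * y) = 2 * V / d^2" .
  assume "d \<noteq> 0"
  moreover have "2 * V = s * d^2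
      + (4 * (x^2 - 2 * t^2 * x + t^2) * y - s * (x^2 - t^2) * (x^2 + 2 * x + t^2))"
    unfolding V_def d by algebra
  ultimately show "r_of k (2 * a^2 * x) (4 * a^3 * y) =
      s + (4 * (x^2 - 2 * t^2 * x + t^2) * y - s * (x^2 - t^2) * (x^2 + 2 * x + t^2)) / d^2"
    unfolding r' by (simp add: add_divide_distrib)
qed

text \<open>This is \<open>quartic_identity\<close> divided by \<open>d^4\<close>, with
  \<open>w = r - s\<close> and \<open>s^2 + t^2 = 1\<close> inserted.\<close>

lemma point_imp_cosine_rule:
  fixes k X Y :: rat
  assumes "on_curve k X Y" "denom k X \<noteq> 0"
  shows "q_of k X Y ^ 4 = r_of k X Y ^ 2 - 2 * (2 * k / (k^2 + 1)) * r_of k X Y + 1"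
proof -
  define a where "a = k^2 + 1"
  define s where "s = 2 * k / (k^2 + 1)"
  define t where "t = (k^2 - 1) / (k^2 + 1)"
  define x where "x = X / (2 * a^2)"
  define y where "y = Y / (4 * a^3)"
  define d where "d = x^2 - 2 * x + t^2"
  define W where "W = 4 * (x^2 - 2 * t^2 * x + t^2) * y - s * (x^2 - t^2) * (x^2 + 2 * x + t^2)"
  have a0: "a > 0" and st: "s^2 + t^2 = 1"
    using unit_circle_param[of k] by (simp_all add: s_def t_def a_def)
  have X: "X = 2 * a^2 * x" and Y: "Y = 4 * a^3 * y"
    using a0 by (simp_all add: x_def y_def)
  have curve: "2 * y^2 = x^3 + t^2 * x"
    using assms(1) normalised_coordinates(1)[of k x y] by (simp add: X Y a_def t_def)
  have d0: "d \<noteq> 0"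
    using assms(2) normalised_coordinates(2)[of k x] by (simp add: X a_def t_def d_def)
  have q: "q_of k X Y = (2 * s * y - x^2 + t^2) / d"
    using normalised_coordinates(3)[of k x y] by (simp add: X Y a_def t_def s_def d_def)
  have r: "r_of k X Y = s + W / d^2"
    using normalised_coordinates(4)[of x k y] d0
    by (simp add: X Y a_def t_def s_def d_def W_def)
  have "W^2 = (2 * s * y - x^2 + t^2)^4 - t^2 * d^4"
    using quartic_identity[OF st curve d_def refl W_def] .
  moreover have "2 * s * y - x^2 + t^2 = q_of k X Y * d" and "W = (r_of k X Y - s) * d^2"
    using d0 by (simp_all add: q r)
  ultimately have "d^4 * (q_of k X Y ^ 4) = d^4 * (r_of k X Y ^ 2 - 2 * s * r_of k X Y + 1)"
    using st by algebra
  then show ?thesis using d0 by (simp add: s_def)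
qed

lemma cosine_rule_imp_point:
  fixes s t q r :: rat
  assumes st: "s^2 + t^2 = 1" and t: "t \<noteq> 0" "t \<noteq> 1" and q: "q > 0" and r: "r \<noteq> 0"
    and cos: "q^4 = r^2 - 2 * s * r + 1"
  shows "\<exists>k X Y. k^4 \<noteq> 1 \<and> on_curve k X Y \<and> denom k X \<noteq> 0 \<and> r_of k X Y = r \<and>
    (q_of k X Y)^2 = q^2"
proof -
  \<comment> \<open>Stereographic projection of \<open>(s, t)\<close> from \<open>(0, 1)\<close>,
    defined because \<open>t \<noteq> 1\<close>. The condition \<open>t \<noteq> 0\<close> gives
    \<open>k^4 \<noteq> 1\<close>.\<close>
  define k where "k = s / (1 - t)"
  define w where "w = r - s"
  define a where "a = k^2 + 1"
  have kt: "k * (1 - t) = s" using t by (simp add: k_def)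
  have "(1 - t) * (a * (1 - t)) = (k * (1 - t))^2 + (1 - t)^2"
    unfolding a_def by algebra
  also have "\<dots> = (1 - t) * 2"
    unfolding kt using st by algebra
  finally have at: "a * (1 - t) = 2"
    by (rule mult_left_cancel[THEN iffD1, rotated]) (use t in simp)
  then have a0: "a \<noteq> 0" by auto
  have "k^2 + 1 \<noteq> 0" using a0 by (simp add: a_def)
  have "s * a = k * (a * (1 - t))" unfolding kt[symmetric] by simp
  then have sa: "s * a = 2 * k" unfolding at by simp
  have "t * a = a - a * (1 - t)" by (simp add: algebra_simps)
  then have ta: "t * a = k^2 - 1" unfolding at by (simp add: a_def)
  from sa ta have s_eq: "2 * k / (k^2 + 1) = s" and t_eq: "(k^2 - 1) / (k^2 + 1) = t"
    using \<open>k^2 + 1 \<noteq> 0\<close> by (simp_all add: a_def divide_eq_eq)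
  have w: "w^2 = q^4 - t^2" using cos st w_def by algebra
  have k4: "k^4 \<noteq> 1"
  proof
    assume "k^4 = 1"
    then have "a^2 * t = 0" using ta a_def by algebra
    then show False using a0 t by simp
  qed
  have good: ?thesis
    if q': "q' \<noteq> -1" "q'^2 = q^2"
      and x: "x = (q'^2 - s * w - t^2) / (q' + 1)^2" and d: "x^2 - 2 * x + t^2 \<noteq> 0" for q' x
  proof -
    define y where "y = (w * (q' + t^2) - s * (q'^3 + t^2)) / (q' + 1)^3"
    define d where "d = x^2 - 2 * x + t^2"
    have w': "w^2 = q'^4 - t^2" using w q' by algebra
    note inv = inverse_map[OF st w' q'(1) x y_def d_def]
    have d0: "d \<noteq> 0" using d by (simp add: d_def)
    have "on_curve k (2 * a^2 * x) (4 * a^3 * y)"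
      using normalised_coordinates(1)[of k x y] inv(1) by (simp add: a_def t_eq)
    moreover have "denom k (2 * a^2 * x) \<noteq> 0"
      using normalised_coordinates(2)[of k x] a0 d0 by (simp add: a_def t_eq d_def)
    moreover have "q_of k (2 * a^2 * x) (4 * a^3 * y) = q'"
      using normalised_coordinates(3)[of k x y] d0 inv(2)[symmetric]
      by (simp add: a_def t_eq s_eq d_def)
    moreover have "r_of k (2 * a^2 * x) (4 * a^3 * y) = r"
      using normalised_coordinates(4)[of x k y] d0 inv(3)[symmetric]
      by (simp add: a_def t_eq s_eq d_def w_def)
    ultimately show ?thesis using k4 q' by blast
  qed
  show ?thesis
  proof (cases "q = 1")
    case True
    then have "r * (r - 2 * s) = 0" using cos by algebra
    then have "r = 2 * s" using r by simp
    then have "q^2 - s * w - t^2 = 0" using True st w_def by algebra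
    then show ?thesis using good[of q 0] True t by simp
  next
    case False
    have "\<not> (((q^2 - s * w - t^2) / (q + 1)^2)^2 - 2 * ((q^2 - s * w - t^2) / (q + 1)^2) + t^2 = 0
       \<and> ((q^2 - s * w - t^2) / (1 - q)^2)^2 - 2 * ((q^2 - s * w - t^2) / (1 - q)^2) + t^2 = 0)"
      using exceptional_points_sign[OF st t(1) w q False refl _ refl] by blast
    then show ?thesis
      using good[of q, OF _ _ refl] good[of "-q", OF _ _ refl] q False by auto
  qed
qed

text \<open>\<open>r_of\<close> is a positive multiple of \<open>poly_R\<close>, and the bound is
  \<open>poly_R > 0\<close> solved for \<open>Y\<close>. The divisor is a sum of squares that could
  vanish only at \<open>k = 0\<close>, \<open>X = 2\<close>, where \<open>denom\<close> is
  zero.\<close>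

lemma Y_bound_iff_r_pos:
  fixes k X Y :: rat
  assumes k: "k^4 \<noteq> 1" and den: "denom k X \<noteq> 0"
  shows "Y > 2 * k * (3 * X^3 - 2 * (3 * k^4 + 2 * k^2 + 3) * X^2 + 4 * (k^4 - 1)^2 * X
                - 8 * (k^2 + 1)^2 * (k^2 - 1)^4)
            / ((X - 2 * (k^2 - 1)^2)^2 + 16 * k^2 * (k^2 - 1)^2) \<longleftrightarrow> r_of k X Y > 0"
    (is "Y > ?n / ?e \<longleftrightarrow> _")
proof -
  have "?e \<noteq> 0"
  proof
    assume e: "?e = 0"
    have "(X - 2 * (k^2 - 1)^2)^2 \<ge> 0" "16 * k^2 * (k^2 - 1)^2 \<ge> 0" by simp_all
    with e have "(X - 2 * (k^2 - 1)^2)^2 = 0" "16 * k^2 * (k^2 - 1)^2 = 0" by linarith+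
    moreover have "k^2 - 1 \<noteq> 0" using k by algebra
    ultimately have "k = 0" "X = 2" by auto
    then show False using den by (simp add: denom_def)
  qed
  moreover have "?e \<ge> 0" by simp
  ultimately have "?e > 0" by linarith
  then have "Y > ?n / ?e \<longleftrightarrow> poly_R k X Y > 0"
    unfolding poly_R_def by (simp add: pos_divide_less_eq mult.commute)
  also have "\<dots> \<longleftrightarrow> r_of k X Y > 0"
  proof -
    have "0 < 4 * (k^2 + 1) / (denom k X)^2"
      using den unit_circle_param(4)[of k] by simp
    moreover have "r_of k X Y = 4 * (k^2 + 1) / (denom k X)^2 * poly_R k X Y"
      by (simp add: r_of_def)
    ultimately show ?thesis by (metis mult_pos_pos zero_less_mult_pos)
  qed
  finally show ?thesis .
qed

section \<open>Plane triangles\<close>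

lemma dist_real2: "dist A B = sqrt ((A$1 - B$1)^2 + (A$2 - B$2)^2)" for A B :: "real^2"
  by (simp add: dist_vec_def L2_set_def sum_2 dist_real_def)

text \<open>Heron's formula: for the edge vectors at \<open>A\<close>, the squares of the
  determinant and of the inner product add up to the product of the squared lengths.\<close>

lemma content_triangle_sides:
  fixes A B C :: "real^2"
  shows "16 * (measure lborel (convex hull {A, B, C}))^2 =
    4 * (dist A B)^2 * (dist C A)^2 - ((dist A B)^2 + (dist C A)^2 - (dist B C)^2)^2"
proof -
  have "16 * (measure lborel (convex hull {A, B, C}))^2 =
      4 * ((C$1 - A$1) * (B$2 - A$2) - (B$1 - A$1) * (C$2 - A$2))^2"
    by (simp add: content_triangle power_divide)
  also have "\<dots> = 4 * (dist A B)^2 * (dist C A)^2 - ((dist A B)^2 + (dist C A)^2 - (dist B C)^2)^2"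
    by (simp add: dist_real2) algebra
  finally show ?thesis .
qed

lemma placed_triangle_sides:
  fixes k X Y :: rat
  assumes "on_curve k X Y" "denom k X \<noteq> 0" "r_of k X Y > 0"
  shows "dist (vector [0, 0]) (apex k) = 1"
    and "dist (apex k) (vector [of_rat (r_of k X Y), 0]) = (of_rat (q_of k X Y))\<^sup>2"
    and "dist (vector [0, 0] :: real^2) (vector [of_rat (r_of k X Y), 0]) = of_rat (r_of k X Y)"
proof -
  define s where "s = 2 * k / (k^2 + 1)"
  define t where "t = (k^2 - 1) / (k^2 + 1)"
  define r where "r = r_of k X Y"
  define q where "q = q_of k X Y"
  have st: "s^2 + t^2 = 1" using unit_circle_param(3)[of k] by (simp add: s_def t_def)
  have q4: "q^4 = r^2 - 2 * s * r + 1"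
    using point_imp_cosine_rule[OF assms(1,2)] by (simp add: s_def r_def q_def)
  have apex: "apex k $ 1 = of_rat s" "apex k $ 2 = of_rat t"
    by (simp_all add: apex_def s_def t_def)
  have st': "(of_rat s)^2 + (of_rat t)^2 = (1::real)"
    using arg_cong[OF st, of "of_rat :: rat \<Rightarrow> real"] by (simp add: of_rat_add of_rat_power)
  then show "dist (vector [0, 0]) (apex k) = 1"
    by (simp add: dist_real2 apex)
  \<comment> \<open>The cosine rule at the origin, where the angle has cosine
    \<open>s\<close>.\<close>
  have "(s - r)^2 + t^2 = (q^2)^2" using st q4 by algebra
  from arg_cong[OF this, of "of_rat :: rat \<Rightarrow> real"]
  have "(of_rat s - of_rat r)^2 + (of_rat t)^2 = ((of_rat q :: real)^2)^2"
    by (simp add: of_rat_add of_rat_power of_rat_diff)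
  then have "sqrt ((of_rat s - of_rat r)^2 + (of_rat t)^2) = (of_rat q :: real)^2"
    by (simp only: real_sqrt_abs abs_power2)
  then show "dist (apex k) (vector [of_rat (r_of k X Y), 0]) = (of_rat (q_of k X Y))\<^sup>2"
    by (simp add: dist_real2 apex r_def q_def)
  show "dist (vector [0, 0] :: real^2) (vector [of_rat (r_of k X Y), 0]) = of_rat (r_of k X Y)"
    using assms(3) by (simp add: dist_real2)
qed

lemma corresponds_iff:
  assumes "on_curve k X Y" "denom k X \<noteq> 0" "r_of k X Y > 0"
  shows "corresponds A B C k X Y \<longleftrightarrow> (\<exists>\<mu>::rat. 0 < \<mu> \<and>
    side_lengths A B C = {#of_rat \<mu>, of_rat (\<mu> * (q_of k X Y)^2), of_rat (\<mu> * r_of k X Y)#})"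
  using placed_triangle_sides[OF assms]
  by (simp add: corresponds_def Let_def of_rat_mult of_rat_power)

text \<open>Dividing the triangle by \<open>u^2\<close>, the length of \<open>AB\<close>, gives
  sides \<open>1\<close>, \<open>q^2\<close>, \<open>r\<close>. The angle at \<open>A\<close> has
  rational cosine by the cosine rule and rational sine by the area.\<close>

lemma heron_imp_point:
  fixes A B C :: "real^2"
  assumes heron: "heron_triangle A B C"
    and sq: "perfect_square (dist A B)" "perfect_square (dist B C)"
  shows "\<exists>k X Y. k^4 \<noteq> 1 \<and> on_curve k X Y \<and> denom k X \<noteq> 0 \<and> r_of k X Y > 0 \<and>
    corresponds A B C k X Y"
proof -
  obtain n m :: nat where nm: "dist A B = (real n)\<^sup>2" "dist B C = (real m)\<^sup>2"
    using sq by (auto simp: perfect_square_def)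
  obtain c F :: nat where c: "dist C A = real c" and F: "measure lborel (convex hull {A, B, C}) = real F"
    using heron by (auto simp: heron_triangle_def side_lengths_def elim!: Nats_cases)
  have pos: "n > 0" "m > 0" "c > 0" "F > 0"
    using heron nm c F by (auto simp: heron_triangle_def side_lengths_def)
  define u v z f :: rat where "u = of_nat n" and "v = of_nat m" and "z = of_nat c" and "f = of_nat F"
  have upos: "u > 0" "v > 0" "z > 0" "f > 0"
    using pos by (simp_all add: u_def v_def z_def f_def)
  have "(of_rat (16 * f^2) :: real)
      = of_rat (4 * u^4 * z^2 - (u^4 + z^2 - v^4)^2)"
    using content_triangle_sides[of A B C] unfolding nm c F
    by (simp add: u_def v_def z_def f_def of_rat_mult of_rat_power of_rat_diff of_rat_add)
  then have area: "16 * f^2 = 4 * u^4 * z^2 - (u^4 + z^2 - v^4)^2"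
    by (simp only: of_rat_eq_iff)
  define r where "r = z / u^2"
  define q where "q = v / u"
  define s where "s = (1 + r^2 - q^4) / (2 * r)"
  \<comment> \<open>The negative of the sine at \<open>A\<close>: reflecting the triangle ensures
    \<open>t \<noteq> 1\<close>, even for a right angle.\<close>
  define t where "t = - (2 * f / (u^4 * r))"
  have r0: "r > 0" and q0: "q > 0" using upos by (simp_all add: r_def q_def)
  have t0: "t < 0" using upos r0 by (simp add: t_def)
  have z: "z = r * u^2" and v: "v = q * u" using upos by (simp_all add: r_def q_def)
  have s: "2 * r * s = 1 + r^2 - q^4" using r0 by (simp add: s_def)
  have t: "u^4 * r * t = - 2 * f" using r0 upos by (simp add: t_def)
  have "4 * u^8 * r^2 * (s^2 + t^2) = 4 * u^8 * r^2 * 1"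
    using area s t unfolding z v by algebra
  then have st: "s^2 + t^2 = 1" using r0 upos by simp
  have "q^4 = r^2 - 2 * s * r + 1" using s by algebra
  with st t0 q0 r0 obtain k X Y where kXY: "k^4 \<noteq> 1" "on_curve k X Y" "denom k X \<noteq> 0"
      "r_of k X Y = r" "(q_of k X Y)^2 = q^2"
    using cosine_rule_imp_point[of s t q r] by auto
  have "side_lengths A B C = {#of_rat (u^2), of_rat (u^2 * q^2), of_rat (u^2 * r)#}"
    using upos
    by (simp add: side_lengths_def nm c q_def r_def power_divide)
       (simp add: u_def v_def z_def of_rat_power)
  then have "corresponds A B C k X Y"
    using corresponds_iff[OF kXY(2,3)] kXY(4,5) r0 upos by (auto intro!: exI[of _ "u^2"])
  with kXY r0 show ?thesis by blast
qed

section \<open>Scaling a rational triangle to integers\<close>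

lemma rat_clear_denominator: "\<exists>n::nat. n > 0 \<and> of_nat n * (x::rat) \<in> \<int>"
proof -
  obtain a b :: int where "x = Fract a b" "b > 0" by (cases x) auto
  then have "of_nat (nat b) * x = of_int a" by (simp add: Fract_of_int_quotient)
  then show ?thesis using \<open>b > 0\<close> by (metis Ints_of_int zero_less_nat_eq)
qed

lemma of_rat_Ints_Nats: "x \<in> \<int> \<Longrightarrow> x \<ge> 0 \<Longrightarrow> (of_rat x :: real) \<in> \<nat>"
  by (auto elim!: Ints_cases simp: Nats_altdef2)

text \<open>The placed triangle is scaled by a square \<open>N^2\<close>, which turns the sides
  \<open>1\<close> and \<open>q^2\<close> into the squares of \<open>N\<close> and
  \<open>N * q\<close>. The integer \<open>N\<close> clears the denominators of \<open>q\<close>, of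
  \<open>r\<close> and of the area \<open>r * \<bar>t\<bar> / 2\<close>.\<close>

lemma point_imp_heron:
  fixes k X Y :: rat
  assumes k: "k^4 \<noteq> 1" and p: "on_curve k X Y" "denom k X \<noteq> 0" "r_of k X Y > 0"
  shows "\<exists>A B C. heron_triangle A B C \<and> two_square_sides A B C \<and> corresponds A B C k X Y"
proof -
  define s where "s = 2 * k / (k^2 + 1)"
  define t where "t = (k^2 - 1) / (k^2 + 1)"
  define r where "r = r_of k X Y"
  define q where "q = q_of k X Y"
  have r0: "r > 0" using p by (simp add: r_def)
  have "k^2 - 1 \<noteq> 0" using k by algebra
  then have t0: "t \<noteq> 0" using unit_circle_param(4)[of k] by (simp add: t_def)
  obtain n1 n2 n3 :: nat where n: "n1 > 0" "of_nat n1 * q \<in> \<int>" "n2 > 0" "of_nat n2 * r \<in> \<int>"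
      "n3 > 0" "of_nat n3 * (r * \<bar>t\<bar> / 2) \<in> \<int>"
    using rat_clear_denominator by metis
  define N :: rat where "N = of_nat (n1 * n2 * n3)"
  have N0: "N > 0" using n by (simp add: N_def)
  have NZ: "N \<in> \<int>" by (simp add: N_def)
  have "N * q = of_nat (n2 * n3) * (of_nat n1 * q)" by (simp add: N_def)
  then have Nq: "N * q \<in> \<int>" using n by (metis Ints_mult Ints_of_nat)
  have "N^2 * r = N * (of_nat (n1 * n3) * (of_nat n2 * r))" by (simp add: N_def power2_eq_square)
  then have Nr: "N^2 * r \<in> \<int>" using n NZ by (metis Ints_mult Ints_of_nat)
  have "N^4 * (r * \<bar>t\<bar> / 2) = N^3 * (of_nat (n1 * n2) * (of_nat n3 * (r * \<bar>t\<bar> / 2)))"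
    by (simp add: N_def power3_eq_cube power4_eq_xxxx)
  then have NF: "N^4 * (r * \<bar>t\<bar> / 2) \<in> \<int>"
    using n NZ by (metis Ints_mult Ints_of_nat Ints_power)
  define \<mu> where "\<mu> = (of_rat (N^2) :: real)"
  have \<mu>0: "\<mu> > 0" using N0 by (simp add: \<mu>_def)
  define P Q :: "real^2" where "P = vector [0, 0]" and "Q = vector [of_rat r, 0]"
  define A B C where "A = \<mu> *\<^sub>R P" and "B = \<mu> *\<^sub>R apex k" and "C = \<mu> *\<^sub>R Q"
  have scale: "dist (\<mu> *\<^sub>R x) (\<mu> *\<^sub>R y) = \<mu> * dist x y" for x y :: "real^2"
    using \<mu>0 by (simp add: dist_norm flip: scaleR_diff_right)
  have "dist A B = \<mu>" "dist B C = \<mu> * (of_rat q)^2" "dist C A = \<mu> * of_rat r"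
    using placed_triangle_sides[OF p]
    by (simp_all add: A_def B_def C_def scale P_def Q_def r_def q_def dist_commute)
  then have dists: "dist A B = of_rat (N^2)" "dist B C = of_rat ((N * q)^2)"
      "dist C A = of_rat (N^2 * r)"
    by (simp_all add: \<mu>_def of_rat_mult of_rat_power power_mult_distrib)
  have apex: "apex k $ 1 = of_rat s" "apex k $ 2 = of_rat t"
    by (simp_all add: apex_def s_def t_def)
  have B2: "B $ 2 \<noteq> 0" using \<mu>0 t0 by (simp add: B_def apex)
  have A0: "A = 0" by (simp add: A_def P_def vec_eq_iff forall_2)
  have C2: "C $ 2 = 0" "C $ 1 = of_rat (N^2 * r)"
    by (simp_all add: C_def Q_def \<mu>_def of_rat_mult)
  have "C \<noteq> 0" using C2(2) N0 r0 by auto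
  have "\<not> collinear {A, B, C}"
  proof
    assume "collinear {A, B, C}"
    then have "collinear {0, C, B}" by (simp add: A0 insert_commute)
    then show False using B2 C2 \<open>C \<noteq> 0\<close> by (auto simp: collinear_lemma)
  qed
  moreover have "measure lborel (convex hull {A, B, C}) = of_rat (N^4 * (r * \<bar>t\<bar> / 2))"
  proof -
    have "measure lborel (convex hull {A, B, C}) = \<bar>of_rat (N^2 * r) * (\<mu> * of_rat t)\<bar> / 2"
      by (simp add: content_triangle A0 C2 B_def apex)
    also have "\<dots> = of_rat (\<bar>N^2 * r * (N^2 * t)\<bar> / 2)"
      by (simp add: \<mu>_def of_rat_mult of_rat_divide abs_mult)
    also have "\<bar>N^2 * r * (N^2 * t)\<bar> / 2 = N^4 * (r * \<bar>t\<bar> / 2)"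
      using r0 by (simp add: abs_mult power4_eq_xxxx power2_eq_square)
    finally show ?thesis .
  qed
  moreover have "N^4 * (r * \<bar>t\<bar> / 2) > 0" using N0 r0 t0 by simp
  \<comment> \<open>That \<open>q\<close> is nonzero comes from the geometry: \<open>B\<close> lies
    off the horizontal axis and \<open>C\<close> on it.\<close>
  moreover have "dist B C > 0" using B2 C2 by auto
  moreover have "dist A B > 0" "dist C A > 0" using N0 r0 unfolding dists by simp_all
  moreover have "dist A B \<in> \<nat>" "dist B C \<in> \<nat>" "dist C A \<in> \<nat>"
    unfolding dists using NZ Nq Nr r0 by (intro of_rat_Ints_Nats; simp)+
  ultimately have "heron_triangle A B C"
    using of_rat_Ints_Nats[OF NF] by (auto simp: heron_triangle_def side_lengths_def)
  moreover have "perfect_square (of_rat (x^2))" if x: "x \<in> \<int>" for x :: rat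
  proof -
    obtain i where "x = of_int i" using x by (elim Ints_cases)
    then have "(of_rat (x^2) :: real) = (real (nat \<bar>i\<bar>))\<^sup>2" by (simp add: of_rat_power)
    then show ?thesis unfolding perfect_square_def by blast
  qed
  then have "two_square_sides A B C"
    unfolding two_square_sides_def dists using NZ Nq by blast
  moreover have "corresponds A B C k X Y"
    using N0 unfolding corresponds_iff[OF p] side_lengths_def dists
    by (intro exI[of _ "N^2"]) (simp add: q_def r_def power_mult_distrib)
  ultimately show ?thesis by blast
qed

theorem theorem1p3:
  shows "(\<forall>A B C :: real^2.
            heron_triangle A B C \<and> two_square_sides A B C \<longrightarrow>
            (\<exists>k X Y :: rat. k^4 \<noteq> 1 \<and> nontrivial_point k X Y \<and>
               Y > 2 * k * (3 * X^3 - 2 * (3 * k^4 + 2 * k^2 + 3) * X^2 + 4 * (k^4 - 1)^2 * X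
                            - 8 * (k^2 + 1)^2 * (k^2 - 1)^4)
                   / ((X - 2 * (k^2 - 1)^2)^2 + 16 * k^2 * (k^2 - 1)^2) \<and>
               corresponds A B C k X Y)) \<and>
         (\<forall>k X Y :: rat.
            k^4 \<noteq> 1 \<and> nontrivial_point k X Y \<and>
            Y > 2 * k * (3 * X^3 - 2 * (3 * k^4 + 2 * k^2 + 3) * X^2 + 4 * (k^4 - 1)^2 * X
                         - 8 * (k^2 + 1)^2 * (k^2 - 1)^4)
                / ((X - 2 * (k^2 - 1)^2)^2 + 16 * k^2 * (k^2 - 1)^2) \<longrightarrow>
            (\<exists>A B C :: real^2.
               heron_triangle A B C \<and> two_square_sides A B C \<and> corresponds A B C k X Y))"
proof (intro conjI allI impI)
  fix A B C :: "real^2"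
  assume h: "heron_triangle A B C \<and> two_square_sides A B C"
  \<comment> \<open>Everything depends only on the vertex set and the multiset of sides, so a cyclic
    relabelling makes \<open>AB\<close> and \<open>BC\<close> the square sides.\<close>
  have rot: "side_lengths B C A = side_lengths A B C" "side_lengths C A B = side_lengths A B C"
    by (simp_all add: side_lengths_def add_mset_commute)
  have rot': "{B, C, A} = {A, B, C}" "{C, A, B} = {A, B, C}" by auto
  have heron: "heron_triangle A B C" "heron_triangle B C A" "heron_triangle C A B"
    using h by (simp_all add: heron_triangle_def rot rot')
  have corr: "corresponds B C A = corresponds A B C" "corresponds C A B = corresponds A B C"
    by (intro ext, simp add: corresponds_def rot)+
  have "\<exists>k X Y. k^4 \<noteq> 1 \<and> on_curve k X Y \<and> denom k X \<noteq> 0 \<and> r_of k X Y > 0 \<and>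
      corresponds A B C k X Y"
    using h heron heron_imp_point[of A B C] heron_imp_point[of B C A] heron_imp_point[of C A B]
    unfolding two_square_sides_def corr by blast
  then obtain k X Y where p: "k^4 \<noteq> 1" "on_curve k X Y" "denom k X \<noteq> 0" "r_of k X Y > 0"
      "corresponds A B C k X Y" by blast
  then have "nontrivial_point k X Y" by (simp add: nontrivial_point_def)
  then show "\<exists>k X Y :: rat. k^4 \<noteq> 1 \<and> nontrivial_point k X Y \<and>
               Y > 2 * k * (3 * X^3 - 2 * (3 * k^4 + 2 * k^2 + 3) * X^2 + 4 * (k^4 - 1)^2 * X
                            - 8 * (k^2 + 1)^2 * (k^2 - 1)^4)
                   / ((X - 2 * (k^2 - 1)^2)^2 + 16 * k^2 * (k^2 - 1)^2) \<and>
               corresponds A B C k X Y"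
    using p Y_bound_iff_r_pos[OF p(1,3), of Y] by blast
next
  fix k X Y :: rat
  assume h: "k^4 \<noteq> 1 \<and> nontrivial_point k X Y \<and>
            Y > 2 * k * (3 * X^3 - 2 * (3 * k^4 + 2 * k^2 + 3) * X^2 + 4 * (k^4 - 1)^2 * X
                         - 8 * (k^2 + 1)^2 * (k^2 - 1)^4)
                / ((X - 2 * (k^2 - 1)^2)^2 + 16 * k^2 * (k^2 - 1)^2)"
  then have "on_curve k X Y" "denom k X \<noteq> 0" by (simp_all add: nontrivial_point_def)
  with h show "\<exists>A B C :: real^2.
      heron_triangle A B C \<and> two_square_sides A B C \<and> corresponds A B C k X Y"
    using point_imp_heron[of k X Y] Y_bound_iff_r_pos[of k X Y] by blast
qed

end
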